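(* There exists a finitely generated group $G$ for which the algebra $Tame(G)$ of tame functions on $G$ is not amenable; that is, $Tame(G)$ admits no $G$-invariant mean.
   Context: The finitely generated group $G$ is regarded as a discrete group. A compact $G$-system is a compact Hausdorff space $X$ with an action of $G$ by homeomorphisms. The enveloping semigroup $E(X)$ is the closure of the set of translations $\{x\mapsto gx:g\in G\}$ in $X^X$ with the pointwise topology. $X$ is tame if every $p\in E(X)$ is fragmented as a map $p:X\to X$: for every nonempty $A\subset X$ and every entourage $\varepsilon$ of the compatible uniformity there is an open $O\subset X$ with $O\cap A\neq\emptyset$ and $p(O\cap A)\times p(O\cap A)\subset\varepsilon$ (for metrizable $X$: every $p$ is Baire class 1). $Tame(G)$ is the algebra of functions $f:G\to\mathbb{R}$ coming from tame systems: $f(g)=F(gx_0)$ for all $g\in G$, for some tame compact $G$-system $X$, continuous $F:X\to\mathbb{R}$ and $x_0\in X$. Its Gelfand space is the universal point-transitive tame $G$-system. A mean on $Tame(G)$ is a linear functional $m$ with $m(1)=1=\|m\|$; it is $G$-invariant if $m(L_gf)=m(f)$ for all $g\in G$, $f\in Tame(G)$, where $(L_gf)(h)=f(gh)$. *)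

theory Defs
  imports "HOL-Analysis.Analysis" "HOL-Algebra.Generated_Groups" "HOL-Algebra.Group_Action"
begin

no_notation Congruence.eq_closure_of (\<open>closure'_of\<index>\<close>)

definition finitely_generated_group :: "'a monoid \<Rightarrow> bool" where
  "finitely_generated_group G \<longleftrightarrow>
     group G \<and> (\<exists>S. finite S \<and> S \<subseteq> carrier G \<and> generate G S = carrier G)"

definition compact_system :: "'a monoid \<Rightarrow> 'x topology \<Rightarrow> ('a \<Rightarrow> 'x \<Rightarrow> 'x) \<Rightarrow> bool" where
  "compact_system G X \<phi> \<longleftrightarrow>
     compact_space X \<and> Hausdorff_space X \<and> group_action G (topspace X) \<phi> \<and>
     (\<forall>g\<in>carrier G. homeomorphic_map X X (\<phi> g))"

text \<open>The translations \<open>\<phi> g\<close> of a \<open>group_action\<close> on \<open>topspace X\<close> are extensional, so they are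
  points of the product of copies of \<open>X\<close> indexed by \<open>topspace X\<close>.\<close>

definition enveloping_semigroup ::
    "'a monoid \<Rightarrow> 'x topology \<Rightarrow> ('a \<Rightarrow> 'x \<Rightarrow> 'x) \<Rightarrow> ('x \<Rightarrow> 'x) set" where
  "enveloping_semigroup G X \<phi> =
     (product_topology (\<lambda>_. X) (topspace X)) closure_of (\<phi> ` carrier G)"

text \<open>A compact Hausdorff space has exactly one compatible uniformity, and its entourages are
  the neighbourhoods of the diagonal. The definition is only used for such spaces.\<close>

definition entourage :: "'x topology \<Rightarrow> ('x \<times> 'x) set \<Rightarrow> bool" where
  "entourage X \<epsilon> \<longleftrightarrow>
     \<epsilon> \<subseteq> topspace X \<times> topspace X \<and>
     (\<exists>W. openin (prod_topology X X) W \<and> Id_on (topspace X) \<subseteq> W \<and> W \<subseteq> \<epsilon>)"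

definition fragmented :: "'x topology \<Rightarrow> ('x \<Rightarrow> 'x) \<Rightarrow> bool" where
  "fragmented X p \<longleftrightarrow>
     (\<forall>A \<epsilon>. A \<subseteq> topspace X \<and> A \<noteq> {} \<and> entourage X \<epsilon> \<longrightarrow>
        (\<exists>U. openin X U \<and> U \<inter> A \<noteq> {} \<and> p ` (U \<inter> A) \<times> p ` (U \<inter> A) \<subseteq> \<epsilon>))"

definition tame_system :: "'a monoid \<Rightarrow> 'x topology \<Rightarrow> ('a \<Rightarrow> 'x \<Rightarrow> 'x) \<Rightarrow> bool" where
  "tame_system G X \<phi> \<longleftrightarrow>
     compact_system G X \<phi> \<and> (\<forall>p\<in>enveloping_semigroup G X \<phi>. fragmented X p)"

text \<open>Functions on \<open>G\<close> are represented by extensional functions on \<open>carrier G\<close>. A formula cannot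
  quantify over the type of the points of \<open>X\<close>, so the points are taken in \<open>'a set set\<close>. This
  loses nothing: only the closure of the orbit of \<open>x\<^sub>0\<close> matters, and a point \<open>x\<close> of it is determined
  by the family of those subsets \<open>A\<close> of \<open>G\<close> for which \<open>x\<close> lies in the closure of \<open>A x\<^sub>0\<close>. Lemma
  \<open>tame_functionsI\<close> below shows that systems with points in any other type give no further
  functions.\<close>

definition tame_functions :: "'a monoid \<Rightarrow> ('a \<Rightarrow> real) set" where
  "tame_functions G =
     {f \<in> extensional (carrier G).
        \<exists>(X :: 'a set set topology) \<phi> F x\<^sub>0.
          tame_system G X \<phi> \<and> continuous_map X euclideanreal F \<and> x\<^sub>0 \<in> topspace X \<and>
          (\<forall>g\<in>carrier G. f g = F (\<phi> g x\<^sub>0))}"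

text \<open>The last clause says that the operator norm of \<open>m\<close>, for the supremum norm on
  \<open>tame_functions G\<close>, is 1. The supremum is taken in \<open>ereal\<close>, where it exists also for an
  unbounded functional.\<close>

definition tame_mean :: "'a monoid \<Rightarrow> (('a \<Rightarrow> real) \<Rightarrow> real) \<Rightarrow> bool" where
  "tame_mean G m \<longleftrightarrow>
     (\<forall>f\<in>tame_functions G. \<forall>h\<in>tame_functions G.
        m (\<lambda>x\<in>carrier G. f x + h x) = m f + m h) \<and>
     (\<forall>c. \<forall>f\<in>tame_functions G. m (\<lambda>x\<in>carrier G. c * f x) = c * m f) \<and>
     m (\<lambda>x\<in>carrier G. 1) = 1 \<and>
     (SUP f\<in>{f \<in> tame_functions G. \<forall>x\<in>carrier G. \<bar>f x\<bar> \<le> 1}. ereal \<bar>m f\<bar>) = 1"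

definition left_translate :: "'a monoid \<Rightarrow> 'a \<Rightarrow> ('a \<Rightarrow> real) \<Rightarrow> 'a \<Rightarrow> real" where
  "left_translate G g f = (\<lambda>h\<in>carrier G. f (g \<otimes>\<^bsub>G\<^esub> h))"

definition tame_amenable :: "'a monoid \<Rightarrow> bool" where
  "tame_amenable G \<longleftrightarrow>
     (\<exists>m. tame_mean G m \<and>
        (\<forall>g\<in>carrier G. \<forall>f\<in>tame_functions G. m (left_translate G g f) = m f))"


subsection \<open>Independence of the choice of type\<close>

lemma tame_system_embedding:
  fixes X :: "'x topology" and Z :: "'z topology"
  assumes X: "tame_system G X \<phi>" and Z: "compact_system G Z \<psi>"
    and emb: "embedding_map Z X i"
    and eqv: "\<And>g z. g \<in> carrier G \<Longrightarrow> z \<in> topspace Z \<Longrightarrow> i (\<psi> g z) = \<phi> g (i z)"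
  shows "tame_system G Z \<psi>"
proof -
  let ?iZ = "i ` topspace Z"
  have hom: "homeomorphic_map Z (subtopology X ?iZ) i"
    using emb by (simp add: embedding_map_def)
  have ci: "continuous_map Z X i"
    using homeomorphic_imp_continuous_map[OF hom] by (rule continuous_map_into_fulltopology)
  have inj: "inj_on i (topspace Z)"
    using hom by (rule homeomorphic_imp_injective_map)
  have iZ: "?iZ \<subseteq> topspace X"
    using ci by (auto simp: continuous_map_def)
  have cX: "compact_space X" and hX: "Hausdorff_space X" and cZ: "compact_space Z"
    and homX: "\<And>g. g \<in> carrier G \<Longrightarrow> homeomorphic_map X X (\<phi> g)"
    and homZ: "\<And>g. g \<in> carrier G \<Longrightarrow> homeomorphic_map Z Z (\<psi> g)"
    and actX: "group_action G (topspace X) \<phi>" and actZ: "group_action G (topspace Z) \<psi>"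
    using X Z by (auto simp: tame_system_def compact_system_def)
  have closed_iZ: "closedin X ?iZ"
    using image_compactin[OF _ ci] cZ hX compactin_imp_closedin compact_space_def by blast
  let ?XX = "product_topology (\<lambda>_. X) (topspace X)"
  let ?ZZ = "product_topology (\<lambda>_. Z) (topspace Z)"
  let ?ZX = "product_topology (\<lambda>_. X) (topspace Z)"
  let ?R = "\<lambda>p. \<lambda>z\<in>topspace Z. p (i z)"
  let ?I = "\<lambda>q. \<lambda>z\<in>topspace Z. i (q z)"
  have cR: "continuous_map ?XX ?ZX ?R"
    unfolding continuous_map_componentwise
    using iZ by (auto intro!: continuous_map_product_projection)
  have cI: "continuous_map ?ZZ ?ZX ?I"
    unfolding continuous_map_componentwise
  proof (intro conjI ballI)
    fix k assume k: "k \<in> topspace Z"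
    have "continuous_map ?ZZ X (i \<circ> (\<lambda>q. q k))"
      using k by (intro continuous_map_compose[OF _ ci] continuous_map_product_projection)
    then show "continuous_map ?ZZ X (\<lambda>x. ?I x k)"
      using k by (simp add: o_def)
  qed auto
  have transZ: "\<psi> ` carrier G \<subseteq> topspace ?ZZ"
    using group_action.bij_prop0[OF actZ] by (auto simp: Bij_def PiE_def Pi_def bij_betw_def)
  have transX: "\<phi> ` carrier G \<subseteq> topspace ?XX"
    using group_action.bij_prop0[OF actX] by (auto simp: Bij_def PiE_def Pi_def bij_betw_def)
  have "compactin ?XX (enveloping_semigroup G X \<phi>)"
    unfolding enveloping_semigroup_def
    by (intro closedin_compact_space) (auto simp: compact_space_product_topology cX)
  then have "compactin ?ZX (?R ` enveloping_semigroup G X \<phi>)"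
    using image_compactin cR by blast
  then have clR: "closedin ?ZX (?R ` enveloping_semigroup G X \<phi>)"
    by (intro compactin_imp_closedin) (auto simp: Hausdorff_space_product_topology hX)
  let ?C = "{q \<in> topspace ?ZZ. ?I q \<in> ?R ` enveloping_semigroup G X \<phi>}"
  have clC: "closedin ?ZZ ?C"
    using closedin_continuous_map_preimage[OF cI clR] .
  have "\<psi> ` carrier G \<subseteq> ?C"
  proof
    fix q assume "q \<in> \<psi> ` carrier G"
    then obtain g where g: "g \<in> carrier G" "q = \<psi> g" by auto
    have "?I q = ?R (\<phi> g)"
      using g eqv by (auto simp: restrict_def)
    moreover have "\<phi> g \<in> enveloping_semigroup G X \<phi>"
      using g closure_of_subset[OF transX] by (auto simp: enveloping_semigroup_def)
    ultimately show "q \<in> ?C"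
      using g transZ by blast
  qed
  then have sub: "enveloping_semigroup G Z \<psi> \<subseteq> ?C"
    using clC unfolding enveloping_semigroup_def[of G Z \<psi>] by (rule closure_of_minimal)
  have "fragmented Z q" if q: "q \<in> enveloping_semigroup G Z \<psi>" for q
    unfolding fragmented_def
  proof (intro allI impI)
    fix A \<epsilon> assume *: "A \<subseteq> topspace Z \<and> A \<noteq> {} \<and> entourage Z \<epsilon>"
    obtain p where p: "p \<in> enveloping_semigroup G X \<phi>" and Iq: "?I q = ?R p"
      and qZ: "q \<in> topspace ?ZZ"
      using q sub by blast
    have iq: "i (q z) = p (i z)" if "z \<in> topspace Z" for z
      using fun_cong[OF Iq, of z] that by simp
    have qz: "q z \<in> topspace Z" if "z \<in> topspace Z" for z
      using qZ that by (auto simp: PiE_def Pi_def)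
    have fp: "fragmented X p" using X p by (simp add: tame_system_def)
    obtain W where W: "openin (prod_topology Z Z) W" "Id_on (topspace Z) \<subseteq> W" "W \<subseteq> \<epsilon>"
      using * by (auto simp: entourage_def)
    let ?i2 = "\<lambda>(x, y). (i x, i y)"
    obtain k where k: "homeomorphic_maps Z (subtopology X ?iZ) i k"
      using hom by (auto simp: homeomorphic_map_maps)
    have h2: "homeomorphic_map (prod_topology Z Z)
        (prod_topology (subtopology X ?iZ) (subtopology X ?iZ)) ?i2"
      using k by (intro homeomorphic_maps_imp_map[where g = "\<lambda>(x, y). (k x, k y)"])
        (simp add: homeomorphic_maps_prod)
    then have "openin (prod_topology (subtopology X ?iZ) (subtopology X ?iZ)) (?i2 ` W)"
      using W(1) homeomorphic_map_openness_eq by blast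
    then obtain W' where W': "openin (prod_topology X X) W'" "?i2 ` W = W' \<inter> ?iZ \<times> ?iZ"
      unfolding subtopology_Times[symmetric] openin_subtopology by blast
    have WZ: "W \<subseteq> topspace Z \<times> topspace Z"
      using openin_subset[OF W(1)] by simp
    let ?N = "topspace (prod_topology X X) - ?iZ \<times> ?iZ"
    have "openin (prod_topology X X) ?N"
      using closed_iZ by (intro openin_diff) (auto simp: closedin_prod_Times_iff openin_prod_Times_iff)
    then have oN: "openin (prod_topology X X) (W' \<union> ?N)"
      using W'(1) by (rule openin_Un[rotated])
    have "Id_on (topspace X) \<subseteq> W' \<union> ?N"
    proof
      fix w assume "w \<in> Id_on (topspace X)"
      then obtain x where x: "x \<in> topspace X" "w = (x, x)" by auto
      show "w \<in> W' \<union> ?N"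
      proof (cases "x \<in> ?iZ")
        case True
        then obtain z where "z \<in> topspace Z" "x = i z" by auto
        then have "?i2 (z, z) \<in> ?i2 ` W" using W(2) by blast
        then show ?thesis using W'(2) x \<open>x = i z\<close> by auto
      qed (use x in auto)
    qed
    then have "entourage X (W' \<union> ?N)"
      unfolding entourage_def using oN openin_subset[OF oN] by auto
    moreover have "i ` A \<subseteq> topspace X" "i ` A \<noteq> {}" using * iZ by auto
    ultimately obtain U where U: "openin X U" "U \<inter> i ` A \<noteq> {}"
      "p ` (U \<inter> i ` A) \<times> p ` (U \<inter> i ` A) \<subseteq> W' \<union> ?N"
      using fp unfolding fragmented_def by meson
    let ?V = "{z \<in> topspace Z. i z \<in> U}"
    have "openin Z ?V" using openin_continuous_map_preimage[OF ci U(1)] .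
    moreover have "?V \<inter> A \<noteq> {}" using U(2) * by auto
    moreover have "q ` (?V \<inter> A) \<times> q ` (?V \<inter> A) \<subseteq> \<epsilon>"
    proof clarify
      fix a b assume ab: "a \<in> A" "b \<in> A" "a \<in> topspace Z" "b \<in> topspace Z" "i a \<in> U" "i b \<in> U"
      then have "p (i a) \<in> p ` (U \<inter> i ` A)" "p (i b) \<in> p ` (U \<inter> i ` A)" by auto
      then have "(p (i a), p (i b)) \<in> W' \<union> ?N" using U(3) by (meson SigmaI subsetD)
      then have "(i (q a), i (q b)) \<in> W' \<inter> ?iZ \<times> ?iZ"
        using ab by (auto simp: iq[symmetric] intro!: imageI qz)
      then obtain c d where cd: "(c, d) \<in> W" "i c = i (q a)" "i d = i (q b)"
        unfolding W'(2)[symmetric] by auto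
      then have "c = q a" "d = q b"
        using WZ ab qz by (auto intro: inj_onD[OF inj])
      then show "(q a, q b) \<in> \<epsilon>" using cd W(3) by auto
    qed
    ultimately show "\<exists>U. openin Z U \<and> U \<inter> A \<noteq> {} \<and> q ` (U \<inter> A) \<times> q ` (U \<inter> A) \<subseteq> \<epsilon>"
      by blast
  qed
  then show ?thesis using Z by (simp add: tame_system_def)
qed

lemma tame_functionsI:
  fixes X :: "'x topology" and G :: "'a monoid"
  assumes X: "tame_system G X \<phi>" and F: "continuous_map X euclideanreal F"
    and x0: "x\<^sub>0 \<in> topspace X" and f: "f \<in> extensional (carrier G)"
    and fF: "\<And>g. g \<in> carrier G \<Longrightarrow> f g = F (\<phi> g x\<^sub>0)"
  shows "f \<in> tame_functions G"
proof -
  have cX: "compact_space X" and hX: "Hausdorff_space X"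
    and homX: "\<And>g. g \<in> carrier G \<Longrightarrow> homeomorphic_map X X (\<phi> g)"
    and actX: "group_action G (topspace X) \<phi>"
    using X by (auto simp: tame_system_def compact_system_def)
  interpret group_action G "topspace X" \<phi> by (rule actX)
  interpret group G using group_hom group_hom.axioms(1) by blast
  define Y where "Y = X closure_of ((\<lambda>g. \<phi> g x\<^sub>0) ` carrier G)"
  have clY: "closedin X Y" and YX: "Y \<subseteq> topspace X"
    by (auto simp: Y_def closure_of_subset_topspace)
  have orbX: "(\<lambda>g. \<phi> g x\<^sub>0) ` carrier G \<subseteq> topspace X"
    using element_image x0 by blast
  have orbY: "\<phi> g x\<^sub>0 \<in> Y" if "g \<in> carrier G" for g
    using closure_of_subset[OF orbX] that by (auto simp: Y_def)
  have x0Y: "x\<^sub>0 \<in> Y"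
    using orbY[OF one_closed] id_eq_one x0 by (metis restrict_apply')
  have invY: "\<phi> g y \<in> Y" if g: "g \<in> carrier G" and y: "y \<in> Y" for g y
  proof -
    have "\<phi> g ` Y \<subseteq> X closure_of (\<phi> g ` (\<lambda>g. \<phi> g x\<^sub>0) ` carrier G)"
      unfolding Y_def
      using homX[OF g] homeomorphic_imp_continuous_map continuous_map_image_closure_subset by blast
    also have "\<dots> \<subseteq> Y"
      unfolding Y_def
    proof (rule closure_of_mono, clarify)
      fix h assume h: "h \<in> carrier G"
      have "\<phi> g (\<phi> h x\<^sub>0) = \<phi> (g \<otimes>\<^bsub>G\<^esub> h) x\<^sub>0"
        using composition_rule[OF x0 g h] by simp
      then show "\<phi> g (\<phi> h x\<^sub>0) \<in> (\<lambda>g. \<phi> g x\<^sub>0) ` carrier G"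
        using g h by auto
    qed
    finally show ?thesis using y by blast
  qed
  define j :: "'x \<Rightarrow> 'a set set"
    where "j = (\<lambda>x. {A. A \<subseteq> carrier G \<and> x \<in> X closure_of ((\<lambda>g. \<phi> g x\<^sub>0) ` A)})"
  have injj: "inj_on j Y"
  proof (rule inj_onI, rule ccontr)
    fix x y assume xy: "x \<in> Y" "y \<in> Y" "j x = j y" "x \<noteq> y"
    then obtain U V where UV: "openin X U" "openin X V" "x \<in> U" "y \<in> V" "disjnt U V"
      using hX YX unfolding Hausdorff_space_def by (meson subsetD)
    define A where "A = {g \<in> carrier G. \<phi> g x\<^sub>0 \<in> U}"
    have "x \<in> X closure_of ((\<lambda>g. \<phi> g x\<^sub>0) ` A)"
      unfolding in_closure_of
    proof (intro conjI allI impI)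
      show "x \<in> topspace X" using xy YX by blast
      fix T assume T: "x \<in> T \<and> openin X T"
      then have "openin X (T \<inter> U)" "x \<in> T \<inter> U" using UV by auto
      then obtain t where "t \<in> (\<lambda>g. \<phi> g x\<^sub>0) ` carrier G" "t \<in> T \<inter> U"
        using xy(1) unfolding Y_def in_closure_of by meson
      then show "\<exists>y. y \<in> (\<lambda>g. \<phi> g x\<^sub>0) ` A \<and> y \<in> T" unfolding A_def by blast
    qed
    then have "A \<in> j x" by (auto simp: j_def A_def)
    then have "A \<in> j y" using xy(3) by simp
    then have "y \<in> X closure_of ((\<lambda>g. \<phi> g x\<^sub>0) ` A)" by (simp add: j_def)
    then obtain t where "t \<in> (\<lambda>g. \<phi> g x\<^sub>0) ` A" "t \<in> V"
      using UV(2,4) unfolding in_closure_of by meson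
    then show False using UV(5) by (auto simp: A_def disjnt_def)
  qed
  define i where "i = inv_into Y j"
  have ij: "i (j y) = y" if "y \<in> Y" for y using injj that by (simp add: i_def)
  define Z where "Z = pullback_topology (j ` Y) i X"
  have tZ: "topspace Z = j ` Y"
    using ij YX by (auto simp: Z_def topspace_pullback_topology)
  have iZ: "i ` topspace Z = Y" using ij by (force simp: tZ)
  have hom: "homeomorphic_map Z (subtopology X Y) i"
  proof (rule bijective_open_imp_homeomorphic_map)
    show "continuous_map Z (subtopology X Y) i"
      unfolding continuous_map_in_subtopology
    proof
      show "continuous_map Z X i"
        using continuous_map_pullback[OF continuous_map_id, of "j ` Y" i X] by (simp add: Z_def)
      show "i \<in> topspace Z \<rightarrow> Y" using iZ by auto
    qed
    show "open_map Z (subtopology X Y) i"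
      unfolding open_map_def
    proof (intro allI impI)
      fix S assume "openin Z S"
      then obtain U where U: "openin X U" "S = i -` U \<inter> j ` Y"
        by (auto simp: Z_def openin_pullback_topology)
      have "i ` S = U \<inter> Y" unfolding U(2) using ij by force
      then show "openin (subtopology X Y) (i ` S)" using U(1) by (auto simp: openin_subtopology)
    qed
    show "i ` topspace Z = topspace (subtopology X Y)" using iZ YX by auto
    show "inj_on i (topspace Z)" using ij by (auto simp: tZ inj_on_def)
  qed
  have emb: "embedding_map Z X i" using hom iZ by (simp add: embedding_map_def)
  define \<psi> where "\<psi> = (\<lambda>g. \<lambda>z\<in>topspace Z. j (\<phi> g (i z)))"
  have iY: "i z \<in> Y" if "z \<in> topspace Z" for z using iZ that by blast
  have ji: "j (i z) = z" if "z \<in> topspace Z" for z using ij that by (auto simp: tZ)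
  have \<psi>Z: "\<psi> g z \<in> topspace Z" if "g \<in> carrier G" "z \<in> topspace Z" for g z
    using that iY invY by (auto simp: \<psi>_def tZ)
  have eqv: "i (\<psi> g z) = \<phi> g (i z)" if "g \<in> carrier G" "z \<in> topspace Z" for g z
    using that iY invY ij by (auto simp: \<psi>_def)
  have \<psi>mult: "\<psi> (g \<otimes>\<^bsub>G\<^esub> h) z = \<psi> g (\<psi> h z)"
    if "g \<in> carrier G" "h \<in> carrier G" "z \<in> topspace Z" for g h z
  proof -
    have "\<psi> (g \<otimes>\<^bsub>G\<^esub> h) z = j (\<phi> (g \<otimes>\<^bsub>G\<^esub> h) (i z))" using that by (simp add: \<psi>_def)
    also have "\<phi> (g \<otimes>\<^bsub>G\<^esub> h) (i z) = \<phi> g (\<phi> h (i z))"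
      using composition_rule that iY YX by blast
    also have "\<dots> = \<phi> g (i (\<psi> h z))" using eqv that by simp
    finally show ?thesis using that \<psi>Z by (simp add: \<psi>_def)
  qed
  have \<psi>one: "\<psi> \<one>\<^bsub>G\<^esub> z = z" if "z \<in> topspace Z" for z
  proof -
    have "\<phi> \<one>\<^bsub>G\<^esub> (i z) = i z"
      using id_eq_one iY[OF that] YX by (metis restrict_apply' subsetD)
    then show ?thesis using that ji by (simp add: \<psi>_def)
  qed
  have c\<psi>: "continuous_map Z Z (\<psi> g)" if g: "g \<in> carrier G" for g
  proof -
    have ci: "continuous_map Z X i"
      using hom homeomorphic_imp_continuous_map continuous_map_into_fulltopology by blast
    have "continuous_map Z X (\<phi> g \<circ> i)"
      using continuous_map_compose[OF ci] homX[OF g] homeomorphic_imp_continuous_map by blast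
    then have "continuous_map Z X (i \<circ> \<psi> g)"
      by (rule continuous_map_eq) (use eqv g in auto)
    moreover have "topspace Z \<subseteq> \<psi> g -` (j ` Y)" using \<psi>Z g by (auto simp: tZ)
    ultimately show ?thesis
      using continuous_map_pullback'[of Z X i "\<psi> g" "j ` Y"] unfolding Z_def[symmetric] by blast
  qed
  have hom\<psi>: "homeomorphic_map Z Z (\<psi> g)" if g: "g \<in> carrier G" for g
  proof -
    have "homeomorphic_maps Z Z (\<psi> g) (\<psi> (inv\<^bsub>G\<^esub> g))"
      unfolding homeomorphic_maps_def
      using g c\<psi> \<psi>mult[of "inv\<^bsub>G\<^esub> g" g] \<psi>mult[of g "inv\<^bsub>G\<^esub> g"] \<psi>one by auto
    then show ?thesis using homeomorphic_maps_imp_map by blast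
  qed
  have Bij: "\<psi> g \<in> Bij (topspace Z)" if "g \<in> carrier G" for g
    using homeomorphic_imp_surjective_map[OF hom\<psi>[OF that]]
      homeomorphic_imp_injective_map[OF hom\<psi>[OF that]]
    by (simp add: Bij_def bij_betw_def) (simp add: \<psi>_def)
  have "group_action G (topspace Z) \<psi>"
    unfolding group_action_def group_hom_def group_hom_axioms_def
  proof (intro conjI homI)
    show "group G" by (rule is_group)
    show "group (BijGroup (topspace Z))" by (rule group_BijGroup)
    show "\<psi> g \<in> carrier (BijGroup (topspace Z))" if "g \<in> carrier G" for g
      using Bij[OF that] by (simp add: BijGroup_def)
    fix g h assume gh: "g \<in> carrier G" "h \<in> carrier G"
    have "\<psi> (g \<otimes>\<^bsub>G\<^esub> h) = compose (topspace Z) (\<psi> g) (\<psi> h)"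
    proof
      fix z show "\<psi> (g \<otimes>\<^bsub>G\<^esub> h) z = compose (topspace Z) (\<psi> g) (\<psi> h) z"
        using \<psi>mult gh by (cases "z \<in> topspace Z") (auto simp: compose_def \<psi>_def)
    qed
    then show "\<psi> (g \<otimes>\<^bsub>G\<^esub> h) = \<psi> g \<otimes>\<^bsub>BijGroup (topspace Z)\<^esub> \<psi> h"
      using Bij gh by (simp add: BijGroup_def)
  qed
  moreover have "compact_space Z"
    using homeomorphic_compact_space[OF homeomorphic_map_imp_homeomorphic_space[OF hom]]
      compact_space_subtopology[OF closedin_compact_space[OF cX clY]] by simp
  moreover have "Hausdorff_space Z"
    using homeomorphic_Hausdorff_space[OF homeomorphic_map_imp_homeomorphic_space[OF hom]]
      Hausdorff_space_subtopology[OF hX] by simp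
  ultimately have "compact_system G Z \<psi>" using hom\<psi> by (simp add: compact_system_def)
  then have "tame_system G Z \<psi>" using tame_system_embedding[OF X _ emb] eqv by blast
  moreover have "continuous_map Z euclideanreal (F \<circ> i)"
    by (rule continuous_map_compose[OF continuous_map_into_fulltopology
          [OF homeomorphic_imp_continuous_map[OF hom]] F])
  moreover have "j x\<^sub>0 \<in> topspace Z" using x0Y tZ by blast
  moreover have "f g = (F \<circ> i) (\<psi> g (j x\<^sub>0))" if "g \<in> carrier G" for g
    using that fF eqv[OF that \<open>j x\<^sub>0 \<in> topspace Z\<close>] ij[OF x0Y] by simp
  ultimately show ?thesis unfolding tame_functions_def using f by blast
qed

end

theory Submission
  imports Defs "HOL-Library.Nat_Bijection"
begin

text \<open>
  The group is the free product \<open>G\<close> of three groups of order two, generated by involutions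
  \<open>s\<^sub>0, s\<^sub>1, s\<^sub>2\<close>, and the tame system is its boundary: the infinite words over
  \<open>{0, 1, 2}\<close> without equal neighbours. The generator \<open>s\<^sub>i\<close> deletes the first letter of
  a word if that letter is \<open>i\<close>, and puts \<open>i\<close> in front otherwise.

  No mean is invariant, because no probability measure on the boundary is. Let \<open>C\<^sub>i\<close> be the set of
  boundary points with first letter \<open>i\<close>. Then \<open>s\<^sub>i\<close> exchanges \<open>C\<^sub>i\<close> with its complement,
  so each \<open>C\<^sub>i\<close> would have measure \<open>1/2\<close>; but the three sets partition the boundary.
  In terms of functions on \<open>G\<close>, the indicator \<open>f\<^sub>i\<close> of \<open>{g. g x\<^sub>0 \<in> C\<^sub>i}\<close> satisfies
  \<open>f\<^sub>i + L f\<^sub>i = 1\<close> for the translation \<open>L\<close> by \<open>s\<^sub>i\<close>, while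
  \<open>f\<^sub>0 + f\<^sub>1 + f\<^sub>2 = 1\<close>. These functions are tame as soon as the boundary is a tame system.

  The boundary is tame because \<open>G\<close> acts on it like a convergence group. A long reduced word \<open>w\<close>
  sends every infinite word, except those that agree with the inverse of \<open>w\<close> for a long time, into
  a small neighbourhood of \<open>w\<close>; a short word preserves closeness. Since the inverse of \<open>w\<close>
  cannot agree for long with both of two distinct points \<open>y\<close> and \<open>z\<close>, there are neighbourhoods
  of \<open>y\<close> and \<open>z\<close>, chosen once for all \<open>g \<in> G\<close>, one of which has a small image under \<open>g\<close>
  (\<open>tame_system_boundary\<close>). This property passes to pointwise limits of translations and gives
  fragmentedness (\<open>tame_system_if_pairwise_small\<close>).
\<close>


section \<open>A criterion for tameness\<close>

text \<open>
  A set with two distinct points \<open>y\<close>, \<open>z\<close> meets both \<open>U\<close> and \<open>V\<close>, so it suffices that the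
  alternative for translations also holds for every \<open>p\<close> in the enveloping semigroup. If it failed
  for \<open>p\<close>, two pairs of points would witness this; a translation that is close to \<open>p\<close> at these
  four points would violate the alternative as well. To make the failure an open condition on \<open>p\<close>,
  the hypothesis is applied to an open set whose closure lies in the given entourage.
\<close>

lemma tame_system_if_pairwise_small:
  fixes X :: "'x topology"
  assumes X: "compact_system G X \<phi>"
    and small: "\<And>W y z. \<lbrakk>openin (prod_topology X X) W; Id_on (topspace X) \<subseteq> W;
        y \<in> topspace X; z \<in> topspace X; y \<noteq> z\<rbrakk> \<Longrightarrow>
      \<exists>U V. openin X U \<and> openin X V \<and> y \<in> U \<and> z \<in> V \<and>
        (\<forall>g\<in>carrier G. \<phi> g ` U \<times> \<phi> g ` U \<subseteq> W \<or> \<phi> g ` V \<times> \<phi> g ` V \<subseteq> W)"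
  shows "tame_system G X \<phi>"
proof -
  have cX: "compact_space X" and hX: "Hausdorff_space X"
    using X by (auto simp: compact_system_def)
  let ?XX = "prod_topology X X"
  let ?P = "product_topology (\<lambda>_. X) (topspace X)"
  have normal: "normal_space ?XX"
    using cX hX by (intro compact_Hausdorff_or_regular_imp_normal_space)
      (auto simp: compact_space_prod_topology Hausdorff_space_prod_topology)
  have diag: "closedin ?XX (Id_on (topspace X))"
  proof -
    have "Id_on (topspace X) = (\<lambda>x. (x, x)) ` topspace X" by auto
    then show ?thesis using hX by (simp add: Hausdorff_space_closedin_diagonal)
  qed
  have "fragmented X p" if p: "p \<in> enveloping_semigroup G X \<phi>" for p
    unfolding fragmented_def
  proof (intro allI impI)
    fix A \<epsilon> assume *: "A \<subseteq> topspace X \<and> A \<noteq> {} \<and> entourage X \<epsilon>"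
    then obtain W where W: "openin ?XX W" "Id_on (topspace X) \<subseteq> W" "W \<subseteq> \<epsilon>"
      by (auto simp: entourage_def)
    have pP: "p \<in> topspace ?P"
      using p in_closure_of[of p ?P] unfolding enveloping_semigroup_def by metis
    then have pX: "p x \<in> topspace X" if "x \<in> topspace X" for x
      using that by (auto simp: PiE_def Pi_def)
    show "\<exists>U. openin X U \<and> U \<inter> A \<noteq> {} \<and> p ` (U \<inter> A) \<times> p ` (U \<inter> A) \<subseteq> \<epsilon>"
    proof (cases "\<exists>a. A = {a}")
      case True
      then obtain a where a: "A = {a}" ..
      then have "(p a, p a) \<in> \<epsilon>" using W pX * by blast
      then show ?thesis using a * by (intro exI[of _ "topspace X"]) auto
    next
      case False
      then obtain y z where yz: "y \<in> A" "z \<in> A" "y \<noteq> z" using * by blast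
      obtain W' where W': "openin ?XX W'" "Id_on (topspace X) \<subseteq> W'" "?XX closure_of W' \<subseteq> W"
        using normal diag W unfolding normal_space_alt by meson
      have yzX: "y \<in> topspace X" "z \<in> topspace X" using yz * by auto
      obtain U V where UV: "openin X U" "openin X V" "y \<in> U" "z \<in> V"
        and alt: "\<forall>g\<in>carrier G. \<phi> g ` U \<times> \<phi> g ` U \<subseteq> W' \<or> \<phi> g ` V \<times> \<phi> g ` V \<subseteq> W'"
        using small[OF W'(1,2) yzX yz(3)] by (elim exE conjE)
      \<comment> \<open>\<open>(p a, p b) \<in> ?O\<close> is an open condition on \<open>p\<close>, and every pair outside \<open>W\<close> is in \<open>?O\<close>.\<close>
      let ?O = "topspace ?XX - ?XX closure_of W'"
      have oO: "openin ?XX ?O" by (rule openin_diff[OF openin_topspace closedin_closure_of])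
      have open_pair: "openin ?P {q \<in> topspace ?P. (q a, q b) \<in> ?O}"
        if "a \<in> topspace X" "b \<in> topspace X" for a b
      proof (rule openin_continuous_map_preimage[OF _ oO])
        show "continuous_map ?P ?XX (\<lambda>q. (q a, q b))"
          using that by (intro continuous_map_pairedI continuous_map_product_projection)
      qed
      have "p ` U \<times> p ` U \<subseteq> W \<or> p ` V \<times> p ` V \<subseteq> W"
      proof (rule ccontr)
        assume "\<not> ?thesis"
        then obtain a b c d where abcd: "a \<in> U" "b \<in> U" "(p a, p b) \<notin> W"
          "c \<in> V" "d \<in> V" "(p c, p d) \<notin> W" by blast
        have mem: "a \<in> topspace X" "b \<in> topspace X" "c \<in> topspace X" "d \<in> topspace X"
          using abcd UV openin_subset by blast+
        let ?T = "{q \<in> topspace ?P. (q a, q b) \<in> ?O} \<inter> {q \<in> topspace ?P. (q c, q d) \<in> ?O}"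
        have "openin ?P ?T"
          by (intro openin_Int open_pair mem)
        moreover have "(p a, p b) \<in> ?O" "(p c, p d) \<in> ?O"
          using abcd W'(3) pX mem by auto
        then have "p \<in> ?T" using pP by simp
        ultimately obtain t where t: "t \<in> \<phi> ` carrier G" "t \<in> ?T"
          using p unfolding enveloping_semigroup_def in_closure_of by meson
        then obtain h where h: "h \<in> carrier G" "t = \<phi> h" by (elim imageE)
        have "W' \<subseteq> ?XX closure_of W'"
          by (rule closure_of_subset[OF openin_subset[OF W'(1)]])
        then have "(\<phi> h a, \<phi> h b) \<notin> W'" "(\<phi> h c, \<phi> h d) \<notin> W'" using t(2) h(2) by blast+
        moreover have "(\<phi> h a, \<phi> h b) \<in> \<phi> h ` U \<times> \<phi> h ` U" "(\<phi> h c, \<phi> h d) \<in> \<phi> h ` V \<times> \<phi> h ` V"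
          using abcd by auto
        ultimately show False using bspec[OF alt h(1)] by (meson subsetD)
      qed
      then show ?thesis
      proof
        assume "p ` U \<times> p ` U \<subseteq> W"
        then show ?thesis using UV yz W(3) by (intro exI[of _ U]) blast
      next
        assume "p ` V \<times> p ` V \<subseteq> W"
        then show ?thesis using UV yz W(3) by (intro exI[of _ V]) blast
      qed
    qed
  qed
  then show ?thesis using X by (simp add: tame_system_def)
qed


section \<open>The free product of three groups of order two\<close>

definition reduced :: "nat list \<Rightarrow> bool" where
  "reduced w \<longleftrightarrow> distinct_adj w \<and> set w \<subseteq> {..<3}"

text \<open>Left multiplication by an involutive generator: a letter cancels against its own copy.\<close>

definition toggle :: "nat \<Rightarrow> nat list \<Rightarrow> nat list" where
  "toggle s w = (if w \<noteq> [] \<and> hd w = s then tl w else s # w)"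

lemma reduced_Nil [simp]: "reduced []"
  by (simp add: reduced_def)

lemma reduced_Cons: "reduced (s # w) \<longleftrightarrow> s < 3 \<and> reduced w \<and> (w \<noteq> [] \<longrightarrow> hd w \<noteq> s)"
  by (auto simp: reduced_def distinct_adj_Cons)

lemma reduced_rev [simp]: "reduced (rev w) \<longleftrightarrow> reduced w"
  by (simp add: reduced_def)

lemma toggle_reduced: "s < 3 \<Longrightarrow> reduced w \<Longrightarrow> reduced (toggle s w)"
  by (cases w) (auto simp: toggle_def reduced_Cons)

lemma toggle_toggle: "reduced w \<Longrightarrow> toggle s (toggle s w) = w"
  by (cases w) (auto simp: toggle_def reduced_Cons split: list.splits)

lemma toggle_eq_Cons: "reduced (s # w) \<Longrightarrow> toggle s w = s # w"
  by (auto simp: toggle_def reduced_Cons)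

lemma foldr_closed:
  assumes "reduced u" "b \<in> B" and f: "\<And>s x. s < 3 \<Longrightarrow> x \<in> B \<Longrightarrow> f s x \<in> B"
  shows "foldr f u b \<in> B"
  using assms(1,2) by (induction u) (auto simp: reduced_Cons intro: f)

lemma foldr_reduced: "reduced u \<Longrightarrow> reduced v \<Longrightarrow> reduced (foldr toggle u v)"
  using foldr_closed[of u v "Collect reduced" toggle] toggle_reduced by auto

text \<open>
  This is the universal property of the free product: any family of involutions \<open>f 0, f 1, f 2\<close> of a
  set \<open>B\<close> extends to an action of the reduced words. Taking for \<open>f\<close> the letters acting on the
  reduced words themselves gives associativity of the multiplication; taking their action on the
  infinite words gives the boundary system.
\<close>

lemma foldr_toggle_action:
  assumes u: "reduced u" and v: "reduced v" and b: "b \<in> B"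
    and closed: "\<And>s x. s < 3 \<Longrightarrow> x \<in> B \<Longrightarrow> f s x \<in> B"
    and invol: "\<And>s x. s < 3 \<Longrightarrow> x \<in> B \<Longrightarrow> f s (f s x) = x"
  shows "foldr f (foldr toggle u v) b = foldr f u (foldr f v b)"
  using u
proof (induction u)
  case (Cons s u)
  let ?w = "foldr toggle u v"
  have su: "s < 3" "reduced u" using Cons.prems by (auto simp: reduced_Cons)
  have w: "reduced ?w" using su v by (simp add: foldr_reduced)
  have "foldr f (toggle s ?w) b = f s (foldr f ?w b)"
  proof (cases "?w \<noteq> [] \<and> hd ?w = s")
    case True
    then obtain w' where w': "?w = s # w'" by (metis list.collapse)
    then have "foldr f w' b \<in> B"
      using w b closed by (intro foldr_closed) (auto simp: reduced_Cons)
    then show ?thesis using w' su invol by (simp add: toggle_def)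
  qed (auto simp: toggle_def)
  then show ?case using Cons.IH su by simp
qed simp

definition word_group :: "nat monoid" where
  "word_group =
     \<lparr>carrier = {n. reduced (list_decode n)},
      mult = (\<lambda>m n. list_encode (foldr toggle (list_decode m) (list_decode n))),
      one = list_encode []\<rparr>"

lemma carrier_word_group: "g \<in> carrier word_group \<longleftrightarrow> reduced (list_decode g)"
  by (simp add: word_group_def)

lemma decode_mult:
  "list_decode (g \<otimes>\<^bsub>word_group\<^esub> h) = foldr toggle (list_decode g) (list_decode h)"
  by (simp add: word_group_def)

lemma decode_one: "list_decode \<one>\<^bsub>word_group\<^esub> = []"
  by (simp add: word_group_def)

lemma foldr_toggle_rev: "reduced w \<Longrightarrow> foldr toggle (rev w) w = []"
proof (induction w)
  case (Cons s w)
  then have "toggle s (s # w) = w" by (simp add: toggle_def)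
  then show ?case using Cons by (simp add: reduced_Cons)
qed simp

lemma group_word_group: "group word_group"
proof (rule groupI)
  fix x y z assume x: "x \<in> carrier word_group" and y: "y \<in> carrier word_group"
  show "x \<otimes>\<^bsub>word_group\<^esub> y \<in> carrier word_group"
    using x y by (simp add: carrier_word_group decode_mult foldr_reduced)
  assume z: "z \<in> carrier word_group"
  have "list_decode (x \<otimes>\<^bsub>word_group\<^esub> y \<otimes>\<^bsub>word_group\<^esub> z) =
      list_decode (x \<otimes>\<^bsub>word_group\<^esub> (y \<otimes>\<^bsub>word_group\<^esub> z))"
    unfolding decode_mult
    using x y z by (intro foldr_toggle_action[where B = "Collect reduced"])
      (auto simp: carrier_word_group toggle_reduced toggle_toggle)
  then show "x \<otimes>\<^bsub>word_group\<^esub> y \<otimes>\<^bsub>word_group\<^esub> z =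
      x \<otimes>\<^bsub>word_group\<^esub> (y \<otimes>\<^bsub>word_group\<^esub> z)"
    by (simp add: list_decode_eq)
next
  show "\<one>\<^bsub>word_group\<^esub> \<in> carrier word_group" by (simp add: carrier_word_group decode_one)
next
  fix x assume x: "x \<in> carrier word_group"
  show "\<one>\<^bsub>word_group\<^esub> \<otimes>\<^bsub>word_group\<^esub> x = x" by (simp add: word_group_def)
  show "\<exists>y\<in>carrier word_group. y \<otimes>\<^bsub>word_group\<^esub> x = \<one>\<^bsub>word_group\<^esub>"
    using x by (intro bexI[of _ "list_encode (rev (list_decode x))"])
      (auto simp: word_group_def foldr_toggle_rev)
qed

definition gen :: "nat \<Rightarrow> nat" where
  "gen s = list_encode [s]"

lemma gen_carrier: "s < 3 \<Longrightarrow> gen s \<in> carrier word_group"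
  by (simp add: carrier_word_group gen_def reduced_Cons)

lemma finitely_generated_word_group: "finitely_generated_group word_group"
  unfolding finitely_generated_group_def
proof (intro conjI exI)
  interpret group word_group by (rule group_word_group)
  show "group word_group" by (rule group_word_group)
  show "finite (gen ` {..<3})" by simp
  show sub: "gen ` {..<3} \<subseteq> carrier word_group" using gen_carrier by auto
  have "list_encode w \<in> generate word_group (gen ` {..<3})" if "reduced w" for w
    using that
  proof (induction w)
    case Nil
    have "list_encode [] = \<one>\<^bsub>word_group\<^esub>" by (simp add: word_group_def)
    then show ?case using generate.one[of word_group "gen ` {..<3}"] by simp
  next
    case (Cons s w)
    then have "gen s \<in> generate word_group (gen ` {..<3})"
      by (intro generate.incl) (auto simp: reduced_Cons)
    moreover have "list_encode (s # w) = gen s \<otimes>\<^bsub>word_group\<^esub> list_encode w"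
      using Cons.prems
      by (simp add: word_group_def gen_def toggle_eq_Cons del: list_encode.simps)
    ultimately show ?case
      using Cons generate.eng[of "gen s" word_group "gen ` {..<3}" "list_encode w"]
      by (simp add: reduced_Cons)
  qed
  then have "carrier word_group \<subseteq> generate word_group (gen ` {..<3})"
    using carrier_word_group list_decode_inverse by (metis subsetI)
  then show "generate word_group (gen ` {..<3}) = carrier word_group"
    using generate_incl[OF sub] by blast
qed


section \<open>The boundary and its cylinder topology\<close>

definition boundary :: "(nat \<Rightarrow> nat) set" where
  "boundary = {x. \<forall>n. x n < 3 \<and> x n \<noteq> x (Suc n)}"

definition boundary_top :: "(nat \<Rightarrow> nat) topology" where
  "boundary_top = subtopology (product_topology (\<lambda>_. discrete_topology {..<3}) UNIV) boundary"

definition cylinder :: "nat \<Rightarrow> (nat \<Rightarrow> nat) \<Rightarrow> (nat \<Rightarrow> nat) set" where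
  "cylinder N x = {y \<in> boundary. \<forall>n<N. y n = x n}"

lemma topspace_boundary [simp]: "topspace boundary_top = boundary"
  by (auto simp: boundary_top_def boundary_def)

lemma continuous_letter:
  "continuous_map boundary_top (discrete_topology {..<3}) (\<lambda>x. x n)"
  unfolding boundary_top_def
  by (intro continuous_map_from_subtopology continuous_map_product_projection) simp

text \<open>
  The cylinders at \<open>x\<close> form a neighbourhood basis at \<open>x\<close>. From here on the topology is only used
  through them.
\<close>

lemma openin_cylinder: "openin boundary_top (cylinder N x)"
proof -
  have "openin boundary_top {y \<in> topspace boundary_top. y n \<in> {x n} \<inter> {..<3}}" for n
    by (rule openin_continuous_map_preimage[OF continuous_letter]) auto
  then have "openin boundary_top
      (\<Inter> ((\<lambda>n. {y \<in> topspace boundary_top. y n \<in> {x n} \<inter> {..<3}}) ` {..<N}) \<inter> topspace boundary_top)"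
    using openin_topspace[of boundary_top]
    by (cases "N = 0") (auto simp del: topspace_boundary intro!: openin_Int openin_INT)
  also have "\<Inter> ((\<lambda>n. {y \<in> topspace boundary_top. y n \<in> {x n} \<inter> {..<3}}) ` {..<N})
      \<inter> topspace boundary_top = cylinder N x"
    by (auto simp: cylinder_def boundary_def)
  finally show ?thesis .
qed

lemma cylinder_self: "x \<in> boundary \<Longrightarrow> x \<in> cylinder N x"
  by (simp add: cylinder_def)

lemma openin_boundaryD:
  assumes U: "openin boundary_top U" and x: "x \<in> U"
  shows "\<exists>N. cylinder N x \<subseteq> U"
proof -
  obtain T where T: "openin (product_topology (\<lambda>_::nat. discrete_topology {..<3::nat}) UNIV) T"
    "U = T \<inter> boundary"
    using U by (auto simp: boundary_top_def openin_subtopology)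
  then obtain V where V: "finite {i. V i \<noteq> {..<3}}" "x \<in> Pi\<^sub>E UNIV V" "Pi\<^sub>E UNIV V \<subseteq> T"
    using x unfolding openin_product_topology_alt by auto
  obtain N where N: "{i. V i \<noteq> {..<3}} \<subseteq> {..<N}"
    using V(1) finite_nat_iff_bounded by blast
  have "cylinder N x \<subseteq> Pi\<^sub>E UNIV V"
  proof
    fix y assume y: "y \<in> cylinder N x"
    have "y i \<in> V i" for i
    proof (cases "i < N")
      case True
      then show ?thesis using y V(2) by (auto simp: cylinder_def)
    next
      case False
      then have "V i = {..<3}" using N by auto
      then show ?thesis using y by (auto simp: cylinder_def boundary_def)
    qed
    then show "y \<in> Pi\<^sub>E UNIV V" by auto
  qed
  then show ?thesis using V(3) T(2) by (intro exI[of _ N]) (auto simp: cylinder_def)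
qed

lemma openin_boundaryI:
  assumes "U \<subseteq> boundary" "\<And>x. x \<in> U \<Longrightarrow> \<exists>N. cylinder N x \<subseteq> U"
  shows "openin boundary_top U"
  using assms cylinder_self openin_cylinder by (subst openin_subopen) (metis subsetD)

lemma compact_boundary: "compact_space boundary_top"
proof -
  let ?P = "product_topology (\<lambda>_::nat. discrete_topology {..<3::nat}) UNIV"
  have cont: "continuous_map ?P (discrete_topology {..<3}) (\<lambda>x. x n)" for n
    by (rule continuous_map_product_projection) simp
  have "closedin ?P {x \<in> topspace ?P. x n \<noteq> x (Suc n)}" for n
  proof -
    have "continuous_map ?P (prod_topology (discrete_topology {..<3}) (discrete_topology {..<3}))
        (\<lambda>x. (x n, x (Suc n)))"
      by (intro continuous_map_pairedI cont)
    then have "continuous_map ?P (discrete_topology ({..<3} \<times> {..<3})) (\<lambda>x. (x n, x (Suc n)))"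
      by (simp add: prod_topology_discrete_topology)
    then have "closedin ?P {x \<in> topspace ?P. (x n, x (Suc n)) \<in> {..<3} \<times> {..<3} - Id}"
      by (rule closedin_continuous_map_preimage) auto
    also have "{x \<in> topspace ?P. (x n, x (Suc n)) \<in> {..<3} \<times> {..<3} - Id} =
        {x \<in> topspace ?P. x n \<noteq> x (Suc n)}"
      by (auto simp: PiE_def Pi_def)
    finally show ?thesis .
  qed
  then have "closedin ?P (\<Inter>n. {x \<in> topspace ?P. x n \<noteq> x (Suc n)})"
    by (intro closedin_INT) auto
  also have "(\<Inter>n. {x \<in> topspace ?P. x n \<noteq> x (Suc n)}) = boundary"
    by (auto simp: boundary_def PiE_def Pi_def)
  finally show ?thesis
    unfolding boundary_top_def
    by (intro compact_space_subtopology closedin_compact_space)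
      (auto simp: compact_space_product_topology compact_space_discrete_topology)
qed

lemma Hausdorff_boundary: "Hausdorff_space boundary_top"
  unfolding boundary_top_def
  by (intro Hausdorff_space_subtopology) (simp add: Hausdorff_space_product_topology)

text \<open>
  The entourages given by agreement of the first \<open>N\<close> letters are cofinal: finitely many of the
  cylinders whose squares lie in \<open>W\<close> cover the space, and the longest of the defining prefixes
  determines \<open>N\<close>.
\<close>

lemma uniform_cylinder:
  assumes W: "openin (prod_topology boundary_top boundary_top) W" and diag: "Id_on boundary \<subseteq> W"
  shows "\<exists>N. \<forall>x y. x \<in> boundary \<longrightarrow> y \<in> cylinder N x \<longrightarrow> (x, y) \<in> W"
proof -
  have "\<exists>N. cylinder N x \<times> cylinder N x \<subseteq> W" if x: "x \<in> boundary" for x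
  proof -
    have "(x, x) \<in> W" using x diag by blast
    then obtain U V where UV: "openin boundary_top U" "openin boundary_top V" "x \<in> U" "x \<in> V"
      "U \<times> V \<subseteq> W"
      using W unfolding openin_prod_topology_alt by meson
    obtain M N where "cylinder M x \<subseteq> U" "cylinder N x \<subseteq> V"
      using UV openin_boundaryD by meson
    moreover have "cylinder (max M N) x \<subseteq> cylinder M x \<inter> cylinder N x"
      by (auto simp: cylinder_def)
    ultimately show ?thesis using UV(5) by blast
  qed
  then obtain r where r: "\<And>x. x \<in> boundary \<Longrightarrow> cylinder (r x) x \<times> cylinder (r x) x \<subseteq> W"
    by metis
  let ?\<U> = "(\<lambda>x. cylinder (r x) x) ` boundary"
  have "boundary \<subseteq> \<Union> ?\<U>" using cylinder_self by blast
  then obtain \<F> where F: "finite \<F>" "\<F> \<subseteq> ?\<U>" "boundary \<subseteq> \<Union> \<F>"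
    using compact_boundary openin_cylinder unfolding compact_space_alt
    by (metis (no_types, lifting) imageE topspace_boundary)
  then obtain S where S: "finite S" "S \<subseteq> boundary" "\<F> = (\<lambda>x. cylinder (r x) x) ` S"
    by (meson finite_subset_image)
  have "(x, y) \<in> W" if x: "x \<in> boundary" and y: "y \<in> cylinder (Max (r ` S)) x" for x y
  proof -
    obtain z where z: "z \<in> S" "x \<in> cylinder (r z) z" using x F(3) S(3) by blast
    have "r z \<le> Max (r ` S)" using S(1) z(1) by simp
    then have "y \<in> cylinder (r z) z" using z(2) y by (simp add: cylinder_def)
    then show ?thesis using r z S(2) by blast
  qed
  then show ?thesis by blast
qed


section \<open>The action on the boundary\<close>


definition btoggle :: "nat \<Rightarrow> (nat \<Rightarrow> nat) \<Rightarrow> nat \<Rightarrow> nat" where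
  "btoggle s x = (if x 0 = s then (\<lambda>n. x (Suc n)) else case_nat s x)"

definition bact :: "nat \<Rightarrow> (nat \<Rightarrow> nat) \<Rightarrow> nat \<Rightarrow> nat" where
  "bact g = (\<lambda>x\<in>boundary. foldr btoggle (list_decode g) x)"

lemma btoggle_cancel: "x 0 = s \<Longrightarrow> btoggle s x = (\<lambda>n. x (Suc n))"
  by (simp add: btoggle_def)

lemma btoggle_prepend: "x 0 \<noteq> s \<Longrightarrow> btoggle s x = case_nat s x"
  by (simp add: btoggle_def)

lemma btoggle_boundary: "s < 3 \<Longrightarrow> x \<in> boundary \<Longrightarrow> btoggle s x \<in> boundary"
  by (auto simp: btoggle_def boundary_def split: nat.splits)

lemma btoggle_btoggle: "x \<in> boundary \<Longrightarrow> btoggle s (btoggle s x) = x"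
proof -
  assume "x \<in> boundary"
  then have "x (Suc 0) \<noteq> x 0" by (auto simp: boundary_def) metis
  then show ?thesis by (auto simp: btoggle_def fun_eq_iff split: nat.splits)
qed

lemma foldr_btoggle_boundary: "reduced w \<Longrightarrow> x \<in> boundary \<Longrightarrow> foldr btoggle w x \<in> boundary"
  by (rule foldr_closed) (auto intro: btoggle_boundary)

lemma bact_boundary: "g \<in> carrier word_group \<Longrightarrow> x \<in> boundary \<Longrightarrow> bact g x \<in> boundary"
  by (simp add: bact_def carrier_word_group foldr_btoggle_boundary)

lemma bact_mult:
  assumes "g \<in> carrier word_group" "h \<in> carrier word_group" "x \<in> boundary"
  shows "bact (g \<otimes>\<^bsub>word_group\<^esub> h) x = bact g (bact h x)"
  using assms foldr_toggle_action[of "list_decode g" "list_decode h" x boundary btoggle]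
  by (simp add: bact_def carrier_word_group decode_mult foldr_btoggle_boundary
      btoggle_boundary btoggle_btoggle)

lemma bact_one: "x \<in> boundary \<Longrightarrow> bact \<one>\<^bsub>word_group\<^esub> x = x"
  by (simp add: bact_def decode_one)

text \<open>
  Each letter of \<open>w\<close> shifts the infinite word by at most one place, so \<open>w\<close> loses at most
  \<open>length w\<close> letters of agreement. This gives continuity, and it controls the short words in the
  proof of tameness.
\<close>

lemma foldr_btoggle_agree:
  assumes "\<forall>n<length w + N. x n = y n"
  shows "\<forall>n<N. foldr btoggle w x n = foldr btoggle w y n"
  using assms
proof (induction w arbitrary: N)
  case (Cons s w)
  then have "\<forall>n<Suc N. foldr btoggle w x n = foldr btoggle w y n"
    using Cons.IH[of "Suc N"] by simp
  then show ?case
    by (cases "foldr btoggle w x 0 = s") (auto simp: btoggle_cancel btoggle_prepend split: nat.splits)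
qed simp

text \<open>
  If the last letter of \<open>w\<close> does not cancel against \<open>x\<close>, no later one cancels either, since the
  letter that it meets is its neighbour in the reduced word \<open>w\<close>: the result is \<open>w\<close> followed
  by \<open>x\<close>.
\<close>

lemma foldr_btoggle_uncancelled:
  assumes "distinct_adj w" "w \<noteq> [] \<longrightarrow> x 0 \<noteq> last w" "n < length w"
  shows "foldr btoggle w x n = w ! n"
  using assms
proof (induction w arbitrary: n)
  case (Cons s w)
  have "foldr btoggle w x 0 \<noteq> s"
  proof (cases "w = []")
    case True
    then show ?thesis using Cons.prems by simp
  next
    case False
    then have "foldr btoggle w x 0 = w ! 0" "hd w \<noteq> s"
      using Cons by (auto simp: distinct_adj_Cons)
    then show ?thesis using False by (simp add: hd_conv_nth)
  qed
  moreover have "foldr btoggle w x m = w ! m" if "m < length w" for m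
    using Cons that by (cases "w = []") (auto simp: distinct_adj_Cons)
  ultimately show ?case using Cons.prems(3)
    by (auto simp: btoggle_prepend split: nat.splits)
qed simp

text \<open>
  Cancellation continues only as long as \<open>x\<close> agrees with \<open>rev w\<close>, the inverse of \<open>w\<close>. A mismatch
  at place \<open>d\<close> therefore leaves all but at most the last \<open>d\<close> letters of \<open>w\<close> standing, and the
  beginning of the result does not depend on \<open>x\<close>.
\<close>

lemma foldr_btoggle_mismatch:
  assumes "distinct_adj w" "d < length w" "x d \<noteq> rev w ! d" "n < length w - d"
  shows "foldr btoggle w x n = w ! n"
  using assms
proof (induction w arbitrary: d x rule: rev_induct)
  case (snoc s w)
  show ?case
  proof (cases "x 0 = s")
    case False
    then show ?thesis using snoc.prems by (intro foldr_btoggle_uncancelled) auto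
  next
    case True
    then obtain e where d: "d = Suc e" using snoc.prems by (cases d) auto
    have "foldr btoggle w (\<lambda>n. x (Suc n)) n = w ! n"
      using snoc.prems d by (intro snoc.IH[of e]) (auto simp: distinct_adj_append_iff)
    moreover have "n < length w" using snoc.prems d by simp
    ultimately show ?thesis using True by (simp add: btoggle_cancel nth_append)
  qed
qed simp

lemma continuous_bact:
  assumes g: "g \<in> carrier word_group"
  shows "continuous_map boundary_top boundary_top (bact g)"
  unfolding continuous_map_def
proof (intro conjI allI impI)
  show "bact g \<in> topspace boundary_top \<rightarrow> topspace boundary_top"
    using g bact_boundary by auto
  fix U assume U: "openin boundary_top U"
  show "openin boundary_top {x \<in> topspace boundary_top. bact g x \<in> U}"
  proof (rule openin_boundaryI)
    fix x assume x: "x \<in> {x \<in> topspace boundary_top. bact g x \<in> U}"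
    obtain N where N: "cylinder N (bact g x) \<subseteq> U" using openin_boundaryD U x by blast
    have "bact g y \<in> cylinder N (bact g x)"
      if "y \<in> cylinder (length (list_decode g) + N) x" for y
    proof -
      have y: "y \<in> boundary" using that by (simp add: cylinder_def)
      then show ?thesis
        using that x foldr_btoggle_agree[of "list_decode g" N y x] bact_boundary[OF g y]
        by (simp add: cylinder_def bact_def)
    qed
    then show "\<exists>N. cylinder N x \<subseteq> {x \<in> topspace boundary_top. bact g x \<in> U}"
      using N by (intro exI[of _ "length (list_decode g) + N"]) (auto simp: cylinder_def)
  qed auto
qed

lemma compact_system_boundary: "compact_system word_group boundary_top bact"
proof -
  interpret group word_group by (rule group_word_group)
  have hom: "homeomorphic_map boundary_top boundary_top (bact g)" if g: "g \<in> carrier word_group" for g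
  proof -
    have "homeomorphic_maps boundary_top boundary_top (bact g) (bact (inv\<^bsub>word_group\<^esub> g))"
      unfolding homeomorphic_maps_def
      using g continuous_bact bact_mult[of "inv\<^bsub>word_group\<^esub> g" g]
        bact_mult[of g "inv\<^bsub>word_group\<^esub> g"] bact_one by auto
    then show ?thesis using homeomorphic_maps_imp_map by blast
  qed
  have Bij: "bact g \<in> Bij boundary" if "g \<in> carrier word_group" for g
    using homeomorphic_imp_surjective_map[OF hom[OF that]]
      homeomorphic_imp_injective_map[OF hom[OF that]]
    by (simp add: Bij_def bij_betw_def) (simp add: bact_def)
  have "group_action word_group boundary bact"
    unfolding group_action_def group_hom_def group_hom_axioms_def
  proof (intro conjI homI)
    show "group word_group" by (rule group_word_group)
    show "group (BijGroup boundary)" by (rule group_BijGroup)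
    show "bact g \<in> carrier (BijGroup boundary)" if "g \<in> carrier word_group" for g
      using Bij[OF that] by (simp add: BijGroup_def)
    fix g h assume gh: "g \<in> carrier word_group" "h \<in> carrier word_group"
    have "bact (g \<otimes>\<^bsub>word_group\<^esub> h) = compose boundary (bact g) (bact h)"
    proof
      fix x show "bact (g \<otimes>\<^bsub>word_group\<^esub> h) x = compose boundary (bact g) (bact h) x"
        using bact_mult gh by (cases "x \<in> boundary") (auto simp: compose_def bact_def)
    qed
    then show "bact (g \<otimes>\<^bsub>word_group\<^esub> h) = bact g \<otimes>\<^bsub>BijGroup boundary\<^esub> bact h"
      using Bij gh by (simp add: BijGroup_def)
  qed
  then show ?thesis
    using hom compact_boundary Hausdorff_boundary by (simp add: compact_system_def)
qed

text \<open>
  If \<open>y\<close> and \<open>z\<close> differ at place \<open>d\<close>, then \<open>rev w\<close> mismatches one of them there whenever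
  \<open>w\<close> is longer than \<open>d\<close>. If \<open>w\<close> is longer than \<open>N + d\<close>, this mismatch makes the first \<open>N\<close>
  letters of the image constant near that point. Otherwise these letters depend only on the first
  \<open>length w + N\<close> letters, hence at most \<open>2 * N + d\<close>, of the argument.
\<close>

lemma tame_system_boundary: "tame_system word_group boundary_top bact"
proof (rule tame_system_if_pairwise_small[OF compact_system_boundary])
  fix W y z
  assume W: "openin (prod_topology boundary_top boundary_top) W" "Id_on (topspace boundary_top) \<subseteq> W"
    and yz: "y \<in> topspace boundary_top" "z \<in> topspace boundary_top" "y \<noteq> z"
  obtain N where N: "\<And>a b. a \<in> boundary \<Longrightarrow> b \<in> cylinder N a \<Longrightarrow> (a, b) \<in> W"
    using uniform_cylinder W by (metis topspace_boundary)
  obtain d where d: "y d \<noteq> z d" using yz(3) by blast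
  \<comment> \<open>The summand 1 makes the words of a cylinder agree also at place \<open>d\<close> itself.\<close>
  define M where "M = 2 * N + d + 1"
  have small: "bact g ` cylinder M c \<times> bact g ` cylinder M c \<subseteq> W"
    if g: "g \<in> carrier word_group" and agree: "\<And>a b n. \<lbrakk>a \<in> cylinder M c; b \<in> cylinder M c; n < N\<rbrakk> \<Longrightarrow>
        foldr btoggle (list_decode g) a n = foldr btoggle (list_decode g) b n" for g c
  proof clarify
    fix a b assume ab: "a \<in> cylinder M c" "b \<in> cylinder M c"
    then have "a \<in> boundary" "b \<in> boundary" by (auto simp: cylinder_def)
    then show "(bact g a, bact g b) \<in> W"
      using agree[OF ab(2,1)] bact_boundary[OF g] by (intro N) (auto simp: cylinder_def bact_def)
  qed
  have "bact g ` cylinder M y \<times> bact g ` cylinder M y \<subseteq> W \<or>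
      bact g ` cylinder M z \<times> bact g ` cylinder M z \<subseteq> W" if g: "g \<in> carrier word_group" for g
  proof (cases "length (list_decode g) \<le> N + d")
    case True
    have "bact g ` cylinder M y \<times> bact g ` cylinder M y \<subseteq> W"
    proof (rule small[OF g])
      fix a b n assume ab: "a \<in> cylinder M y" "b \<in> cylinder M y" "n < N"
      then have "\<forall>n<length (list_decode g) + N. a n = b n"
        using True by (auto simp: cylinder_def M_def)
      then show "foldr btoggle (list_decode g) a n = foldr btoggle (list_decode g) b n"
        using foldr_btoggle_agree ab(3) by blast
    qed
    then show ?thesis ..
  next
    case False
    have dist: "distinct_adj (list_decode g)" using g by (simp add: carrier_word_group reduced_def)
    have *: "bact g ` cylinder M c \<times> bact g ` cylinder M c \<subseteq> W"
      if c: "c d \<noteq> rev (list_decode g) ! d" for c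
    proof (rule small[OF g])
      have val: "foldr btoggle (list_decode g) a n = list_decode g ! n"
        if "a \<in> cylinder M c" "n < N" for a n
        using that c False dist
        by (intro foldr_btoggle_mismatch[of _ d]) (auto simp: cylinder_def M_def)
      fix a b n assume "a \<in> cylinder M c" "b \<in> cylinder M c" "n < N"
      then show "foldr btoggle (list_decode g) a n = foldr btoggle (list_decode g) b n"
        by (simp add: val)
    qed
    show ?thesis using * d by metis
  qed
  then show "\<exists>U V. openin boundary_top U \<and> openin boundary_top V \<and> y \<in> U \<and> z \<in> V \<and>
      (\<forall>g\<in>carrier word_group. bact g ` U \<times> bact g ` U \<subseteq> W \<or> bact g ` V \<times> bact g ` V \<subseteq> W)"
    using yz by (intro exI[of _ "cylinder M y"] exI[of _ "cylinder M z"])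
      (simp add: openin_cylinder cylinder_self)
qed


section \<open>First letters obstruct an invariant mean\<close>

text \<open>
  The first letter of \<open>g x\<^sub>0\<close> for the base point \<open>x\<^sub>0 = 010101\<dots>\<close>; any other boundary point
  would serve as well.
\<close>

definition first_letter :: "nat \<Rightarrow> nat" where
  "first_letter g = bact g (\<lambda>n. n mod 2) 0"

lemma base_boundary: "(\<lambda>n. n mod 2) \<in> boundary"
  by (auto simp: boundary_def mod_Suc less_Suc_eq numeral_3_eq_3)

lemma first_letter_less: "g \<in> carrier word_group \<Longrightarrow> first_letter g < 3"
  using bact_boundary[OF _ base_boundary, of g] by (simp add: first_letter_def boundary_def)

lemma first_letter_tame:
  "(\<lambda>g\<in>carrier word_group. h (first_letter g)) \<in> tame_functions word_group"
proof (rule tame_functionsI[OF tame_system_boundary])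
  have "continuous_map (discrete_topology {..<3}) euclideanreal h" by simp
  from continuous_map_compose[OF continuous_letter this]
  show "continuous_map boundary_top euclideanreal (\<lambda>x. h (x 0))"
    by (simp add: o_def)
qed (use base_boundary in \<open>auto simp: first_letter_def\<close>)

text \<open>
  A generator \<open>s\<close> exchanges the words that begin with \<open>s\<close> and those that do not: the letter behind a
  deleted \<open>s\<close> differs from \<open>s\<close>, because the words have no equal neighbours.
\<close>

lemma first_letter_gen_mult:
  assumes s: "s < 3" and g: "g \<in> carrier word_group"
  shows "first_letter (gen s \<otimes>\<^bsub>word_group\<^esub> g) = s \<longleftrightarrow> first_letter g \<noteq> s"
proof -
  let ?x = "bact g (\<lambda>n. n mod 2)"
  have x: "?x \<in> boundary" using bact_boundary[OF g base_boundary] .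
  have "bact (gen s \<otimes>\<^bsub>word_group\<^esub> g) (\<lambda>n. n mod 2) = bact (gen s) ?x"
    using bact_mult[OF gen_carrier[OF s] g base_boundary] .
  also have "\<dots> = btoggle s ?x" using x by (simp add: bact_def gen_def)
  finally have "first_letter (gen s \<otimes>\<^bsub>word_group\<^esub> g) = btoggle s ?x 0"
    by (simp add: first_letter_def)
  moreover have "?x (Suc 0) \<noteq> ?x 0" using x by (auto simp: boundary_def) metis
  ultimately show ?thesis by (auto simp: btoggle_def first_letter_def)
qed

lemma not_tame_amenable_word_group: "\<not> tame_amenable word_group"
proof
  assume "tame_amenable word_group"
  then obtain m where m: "tame_mean word_group m"
    and inv: "\<And>g f. \<lbrakk>g \<in> carrier word_group; f \<in> tame_functions word_group\<rbrakk> \<Longrightarrow>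
        m (left_translate word_group g f) = m f"
    by (auto simp: tame_amenable_def)
  \<comment> \<open>On functions of the first letter, \<open>m\<close> acts like a measure on \<open>{0, 1, 2}\<close>.\<close>
  define \<mu> where "\<mu> h = m (\<lambda>g\<in>carrier word_group. h (first_letter g))" for h
  have add: "\<mu> (\<lambda>k. h k + h' k) = \<mu> h + \<mu> h'" for h h'
  proof -
    have "m (\<lambda>g\<in>carrier word_group. (\<lambda>g\<in>carrier word_group. h (first_letter g)) g +
        (\<lambda>g\<in>carrier word_group. h' (first_letter g)) g) = \<mu> h + \<mu> h'"
      using m first_letter_tame unfolding tame_mean_def \<mu>_def by blast
    then show ?thesis by (simp add: \<mu>_def cong: restrict_cong)
  qed
  have one: "\<mu> (\<lambda>_. 1) = 1" using m by (simp add: tame_mean_def \<mu>_def)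
  have half: "\<mu> (\<lambda>k. if k = s then 1 else 0) = 1 / 2" if s: "s < 3" for s
  proof -
    let ?f = "\<lambda>g\<in>carrier word_group. if first_letter g = s then 1 else 0 :: real"
    have "left_translate word_group (gen s) ?f =
        (\<lambda>g\<in>carrier word_group. if first_letter g = s then 0 else 1)"
      unfolding left_translate_def
      using first_letter_gen_mult[OF s] gen_carrier[OF s] monoid.m_closed[OF group.is_monoid[OF group_word_group]]
      by (intro restrict_ext) auto
    then have "\<mu> (\<lambda>k. if k = s then 0 else 1) = \<mu> (\<lambda>k. if k = s then 1 else 0)"
      using inv[OF gen_carrier[OF s] first_letter_tame[of "\<lambda>k. if k = s then 1 else 0"]]
      by (simp add: \<mu>_def)
    moreover have "\<mu> (\<lambda>k. if k = s then 1 else 0) + \<mu> (\<lambda>k. if k = s then 0 else 1) = \<mu> (\<lambda>_. 1)"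
      unfolding add[symmetric] by (intro arg_cong[of _ _ \<mu>]) auto
    ultimately show ?thesis using one by simp
  qed
  let ?e = "\<lambda>s k. if k = s then 1 else 0 :: real"
  have partition: "?e 0 k + (?e 1 k + ?e 2 k) = 1" if "k < 3" for k :: nat
  proof -
    have "k = 0 \<or> k = 1 \<or> k = 2" using that by linarith
    then show ?thesis by auto
  qed
  have "\<mu> (\<lambda>_. 1) = \<mu> (\<lambda>k. ?e 0 k + (?e 1 k + ?e 2 k))"
    unfolding \<mu>_def
    by (intro arg_cong[of _ _ m] restrict_ext) (simp only: partition first_letter_less)
  also have "\<dots> = 3 / 2" by (simp only: add) (simp add: half)
  finally show False using one by simp
qed

theorem corollary3p2:
  shows "\<exists>G :: nat monoid. finitely_generated_group G \<and> \<not> tame_amenable G"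
  using finitely_generated_word_group not_tame_amenable_word_group by blast

end
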